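(* Let $m$ be a positive integer. There exists a numerical semigroup of multiplicity $m$ that is simultaneously a discretization of the logarithmic monoid $L$ and a discretization of the golden fractal monoid $F$ if and only if $m\in\{1,2,3,4,5,6,7,8,9,10,12,13,18\}$. Explicitly: there exist real numbers $\alpha_L,\alpha_F\in[0,1]$ such that $\lfloor mL\rfloor_{\alpha_L}=\lfloor mF\rfloor_{\alpha_F}$ and this common set is a numerical semigroup, if and only if $m\in\{1,2,3,4,5,6,7,8,9,10,12,13,18\}$.
   Context: $\mathbb{N}=\{1,2,3,\dots\}$ and $\mathbb{N}_0=\mathbb{N}\cup\{0\}$. A numerical semigroup is an additive submonoid of $\mathbb{N}_0$ (containing $0$) with finite complement in $\mathbb{N}_0$; its multiplicity is its smallest non-zero element. For $r\in\mathbb{R}$ and $\alpha\in[0,1]$, put $\lfloor r\rfloor_\alpha=\lfloor r\rfloor$ if $r-\lfloor r\rfloor<\alpha$, and $\lfloor r\rfloor_\alpha=\lceil r\rceil$ otherwise. For a set $M$ of real numbers and a positive integer $m$, $\lfloor mM\rfloor_\alpha=\{\lfloor mr\rfloor_\alpha: r\in M\}$. A numerical semigroup of multiplicity $m$ is a discretization of $M$ (for $M=L$ or $M=F$ below) if it equals $\lfloor mM\rfloor_\alpha$ for some $\alpha\in[0,1]$. The logarithmic monoid is $L=\{\log_2(i): i\in\mathbb{N}\}$. The golden fractal monoid $F$ is defined as follows. Let $\phi=\frac{1+\sqrt5}{2}$. Put $\pi_1=\{1,\phi\}$. Recursively, for $i\ge1$, if $\pi_i=\{i+\tau_0,i+\tau_1,\dots,i+\tau_{2^i-1}\}$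 with $0=\tau_0<\tau_1<\dots<\tau_{2^i-1}<1$, and one sets $\tau_{2^i}=1$, then $$\pi_{i+1}=\bigcup_{r=0}^{2^i-1}\left\{(i+1)+\tau_r,\ (i+1)+\tau_r+(\phi-1)(\tau_{r+1}-\tau_r)\right\}.$$ Then $F=\{0\}\cup\bigcup_{i\ge1}\pi_i$. *)

theory Defs
  imports "HOL-Analysis.Analysis"
begin

definition numerical_semigroup :: "nat set \<Rightarrow> bool" where
  "numerical_semigroup S \<longleftrightarrow>
     0 \<in> S \<and> (\<forall>a\<in>S. \<forall>b\<in>S. a + b \<in> S) \<and> finite (UNIV - S)"

definition multiplicity_of :: "nat set \<Rightarrow> nat" where
  "multiplicity_of S = (LEAST n. n \<in> S \<and> n \<noteq> 0)"

definition alpha_floor :: "real \<Rightarrow> real \<Rightarrow> int" where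
  "alpha_floor \<alpha> r = (if r - of_int \<lfloor>r\<rfloor> < \<alpha> then \<lfloor>r\<rfloor> else \<lceil>r\<rceil>)"

definition floor_set :: "real \<Rightarrow> nat \<Rightarrow> real set \<Rightarrow> int set" where
  "floor_set \<alpha> m M = {alpha_floor \<alpha> (real m * r) | r. r \<in> M}"

text \<open>Rounding produces integers, whereas numerical semigroups are sets of naturals;
  the two are compared along the embedding \<^const>\<open>int\<close>.\<close>

definition is_discretization :: "nat set \<Rightarrow> real set \<Rightarrow> bool" where
  "is_discretization S M \<longleftrightarrow>
     numerical_semigroup S \<and>
     (\<exists>\<alpha>\<in>{0..1}. int ` S = floor_set \<alpha> (multiplicity_of S) M)"

definition logarithmic_monoid :: "real set" where
  "logarithmic_monoid = {log 2 (real i) | i :: nat. i \<ge> 1}"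

definition golden_ratio :: real where
  "golden_ratio = (1 + sqrt 5) / 2"

text \<open>For the \<open>i\<close>-th period \<open>P\<close>, \<open>golden_tau i P r\<close> is the offset \<open>\<tau>\<^sub>r\<close>: the offsets of the
  elements of \<open>P\<close> from \<open>i\<close> are listed in increasing order from index \<open>0\<close>, and the list is
  extended by the conventional last value \<open>\<tau> = 1\<close> at index \<open>card P = 2 ^ i\<close>.\<close>

definition golden_tau :: "nat \<Rightarrow> real set \<Rightarrow> nat \<Rightarrow> real" where
  "golden_tau i P r = (sorted_list_of_set ((\<lambda>x. x - real i) ` P) @ [1]) ! r"

text \<open>The periods are indexed from \<open>1\<close>; the value at \<open>0\<close> is a dummy.\<close>

fun golden_period :: "nat \<Rightarrow> real set" where
  "golden_period 0 = {}"
| "golden_period (Suc 0) = {1, golden_ratio}"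
| "golden_period (Suc (Suc k)) =
     (let i = Suc k; \<tau> = golden_tau i (golden_period (Suc k)) in
      \<Union>r\<in>{0..2 ^ i - 1}.
        {real (i + 1) + \<tau> r,
         real (i + 1) + \<tau> r + (golden_ratio - 1) * (\<tau> (r + 1) - \<tau> r)})"

definition golden_fractal_monoid :: "real set" where
  "golden_fractal_monoid = {0} \<union> (\<Union>i\<in>{1..}. golden_period i)"

end

theory Submission
  imports Defs
begin

text \<open>
  Both monoids are invariant under $x \mapsto x + 1$ and have $2^s$ elements in $[s, s + 1)$, at
  roughly the same places. Rounding moves a point by less than $1$, so a discretization of
  multiplicity \<open>m\<close> determines the monoid up to an error of about $1 / m$, and for large \<open>m\<close> this is
  finer than the distance between the two monoids: no element of the golden fractal monoid
  is closer than $2 / 31$ to \<open>log 2 9\<close>, which rules out every \<open>m \<ge> 31\<close>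
  (\<open>discretizations_differ\<close>).

  For the remaining \<open>m\<close> everything is a finite computation, because of two facts. First, on a finite
  set of points the parameter \<open>\<alpha>\<close> matters only through the points whose fractional part is less
  than \<open>\<alpha>\<close>; so each rounding is obtained from one of the points as a threshold, and each threshold
  occurs (\<open>alpha_floor_on_finite\<close>, \<open>threshold_realised\<close>). Secondly, the elements
  below \<open>K\<close> of each monoid determine the discretization below \<open>m * K\<close>. All that is needed about the
  finitely many points \<open>m * x\<close> are their integer parts and the order of their fractional parts.
  Both come from integer arithmetic: for the logarithmic monoid from the
  powers $i^m$ shifted into a common binade (\<open>log_entry\<close>), and for the golden
  monoid, whose elements are integer combinations of \<open>1\<close> and the golden section, from
  a Fibonacci approximation that is too good to be noticed by the small coefficients
  which occur (\<open>golden_entry\<close>).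

  If \<open>m \<le> 30\<close> is not in the list, no pair of thresholds gives truncations that agree and are closed
  under addition (\<open>no_common_truncation\<close>); the second condition is essential for \<open>m = 11\<close> and
  \<open>m = 14\<close>. If \<open>m\<close> is in the list, some pair of thresholds gives equal truncations below \<open>6 * m\<close>
  that contain all of $[5m, 6m)$ (\<open>common_witnesses\<close>). Since discretizations are closed
  under adding \<open>m\<close>, they then contain every integer from \<open>5 * m\<close> on, so that they are equal and
  closure under addition is a condition on finitely many sums.
\<close>

section \<open>Rounding with respect to a threshold\<close>

lemma alpha_floor_frac:
  "alpha_floor \<alpha> x = \<lfloor>x\<rfloor> + of_bool (frac x \<noteq> 0 \<and> \<alpha> \<le> frac x)"
proof (cases "x \<in> \<int>")
  case True
  then show ?thesis by (auto simp: alpha_floor_def frac_def elim!: Ints_cases)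
next
  case False
  then have "frac x \<noteq> 0" "\<lceil>x\<rceil> = \<lfloor>x\<rfloor> + 1"
    by (auto simp: frac_eq_0_iff ceiling_altdef Ints_def)
  then show ?thesis by (auto simp: alpha_floor_def frac_def)
qed

lemma alpha_floor_add_int: "alpha_floor \<alpha> (of_int k + x) = k + alpha_floor \<alpha> x"
  by (simp add: alpha_floor_frac frac_def add.commute)

lemma alpha_floor_of_int [simp]: "alpha_floor \<alpha> (of_int k) = k"
  by (simp add: alpha_floor_frac)

lemma alpha_floor_ge: "of_int k \<le> x \<Longrightarrow> k \<le> alpha_floor \<alpha> x"
  by (simp add: alpha_floor_frac le_floor_iff add_increasing2)

lemma alpha_floor_near: "\<bar>of_int (alpha_floor \<alpha> x) - x\<bar> < 1"
proof -
  have "x = of_int \<lfloor>x\<rfloor> + frac x" "0 \<le> frac x" "frac x < 1"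
    by (simp_all add: frac_lt_1) (simp add: frac_def)
  moreover have "real_of_int (alpha_floor \<alpha> x) = of_int \<lfloor>x\<rfloor> \<or>
      frac x \<noteq> 0 \<and> real_of_int (alpha_floor \<alpha> x) = of_int \<lfloor>x\<rfloor> + 1"
    by (simp add: alpha_floor_frac)
  ultimately show ?thesis by (elim disjE conjE) linarith+
qed

text \<open>
  The threshold is the point with the largest fractional part below \<open>\<alpha>\<close>. The point \<open>y\<^sub>0\<close> guarantees
  that there is one, and is itself the threshold for \<open>\<alpha> = 0\<close>, where integers stay fixed although
  their fractional part is not below \<open>\<alpha>\<close>.
\<close>

lemma alpha_floor_on_finite:
  assumes "finite Y" "y\<^sub>0 \<in> Y" "frac y\<^sub>0 = 0" "\<alpha> \<in> {0..1}"
  shows "\<exists>z\<in>Y. \<forall>y\<in>Y. alpha_floor \<alpha> y = \<lfloor>y\<rfloor> + of_bool (frac z < frac y)"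
proof (cases "\<alpha> = 0")
  case True
  have "frac y\<^sub>0 < frac y \<longleftrightarrow> frac y \<noteq> 0 \<and> \<alpha> \<le> frac y" for y
    using assms(3) True frac_ge_0[of y] by linarith
  then show ?thesis using assms(2) by (auto simp: alpha_floor_frac)
next
  case False
  define Z where "Z = {y \<in> Y. frac y < \<alpha>}"
  have "finite Z" "y\<^sub>0 \<in> Z"
    using assms False by (auto simp: Z_def simp del: frac_eq_0_iff)
  then obtain z where z: "z \<in> Z" "\<And>y. y \<in> Z \<Longrightarrow> frac y \<le> frac z"
    using obtains_MAX[of Z frac] Max_ge[of "frac ` Z"] by (metis empty_iff finite_imageI imageI)
  have "frac z < frac y \<longleftrightarrow> frac y \<noteq> 0 \<and> \<alpha> \<le> frac y" if "y \<in> Y" for y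
  proof (cases "frac y < \<alpha>")
    case True
    then show ?thesis using z(2)[of y] that by (simp add: Z_def)
  next
    case False
    then show ?thesis using z(1) frac_ge_0[of z] unfolding Z_def mem_Collect_eq
      by (smt (verit))
  qed
  then show ?thesis using z(1) by (auto simp: alpha_floor_frac Z_def)
qed

text \<open>
  Conversely \<open>\<alpha>\<close> may be taken as the smallest fractional part that has to be rounded up, or \<open>1\<close> if
  there is none.
\<close>

lemma threshold_realised:
  fixes z :: real
  assumes "finite Y"
  shows "\<exists>\<alpha>\<in>{0..1}. \<forall>y\<in>Y. alpha_floor \<alpha> y = \<lfloor>y\<rfloor> + of_bool (frac z < frac y)"
proof
  define A where "A = insert 1 (frac ` {y \<in> Y. frac z < frac y})"
  have fin: "finite A" "A \<noteq> {}" using assms by (auto simp: A_def)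
  then have \<alpha>: "Min A \<in> A" "\<And>a. a \<in> A \<Longrightarrow> Min A \<le> a" by auto
  then show "Min A \<in> {0..1}" by (auto simp: A_def)
  have "frac z < Min A" using \<alpha>(1) frac_lt_1[of z] by (auto simp: A_def)
  moreover have "Min A \<le> frac y" if "y \<in> Y" "frac z < frac y" for y
    using that by (intro \<alpha>(2)) (simp add: A_def)
  ultimately have "frac z < frac y \<longleftrightarrow> frac y \<noteq> 0 \<and> Min A \<le> frac y" if "y \<in> Y" for y
    using that frac_ge_0[of z] by (smt (verit))
  then show "\<forall>y\<in>Y. alpha_floor (Min A) y = \<lfloor>y\<rfloor> + of_bool (frac z < frac y)"
    by (auto simp: alpha_floor_frac)
qed

section \<open>Truncated discretizations as integer lists\<close>

text \<open>
  The table entry of an index records the integer part of its point together with a key;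
  the keys are integers in the same order as the fractional parts, which is all that a threshold
  needs.
\<close>

definition tabulated :: "'i set \<Rightarrow> ('i \<Rightarrow> real) \<Rightarrow> ('i \<Rightarrow> int \<times> int) \<Rightarrow> bool" where
  "tabulated I w t \<longleftrightarrow> (\<forall>p\<in>I. fst (t p) = \<lfloor>w p\<rfloor>) \<and>
     (\<forall>p\<in>I. \<forall>q\<in>I. frac (w p) < frac (w q) \<longleftrightarrow> snd (t p) < snd (t q))"

text \<open>
  The truncation below \<open>N\<close> of the discretization with threshold key \<open>c\<close>. Sorting makes the list
  canonical, so that truncations can be compared as lists.
\<close>

definition truncation :: "int \<Rightarrow> (int \<times> int) list \<Rightarrow> int \<Rightarrow> int list" where
  "truncation N E c =
     sort (remdups (filter (\<lambda>n. n < N) (map (\<lambda>(e, r). if c < r then e + 1 else e) E)))"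

lemma truncation_eq_iff:
  "truncation N E c = truncation N E' c' \<longleftrightarrow> set (truncation N E c) = set (truncation N E' c')"
proof -
  have "truncation N E c = sorted_list_of_set (set (truncation N E c))" for E c
    unfolding truncation_def sorted_list_of_set_sort_remdups[symmetric]
    by (simp only: set_sorted_list_of_set finite_set)
  then show ?thesis by metis
qed

lemma floor_set_below:
  assumes tab: "tabulated I (\<lambda>p. real m * w p) t" and I: "set ps = I"
    and below: "{x \<in> M. x < real K} = w ` I"
    and \<alpha>: "\<forall>p\<in>I. alpha_floor \<alpha> (real m * w p) = \<lfloor>real m * w p\<rfloor> + of_bool (frac (real m * w q) < frac (real m * w p))"
    and q: "q \<in> I"
  shows "floor_set \<alpha> m M \<inter> {..<int (m * K)} = set (truncation (int (m * K)) (map t ps) (snd (t q)))"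
proof -
  have "x \<in> w ` I" if "x \<in> M" "alpha_floor \<alpha> (real m * x) < int (m * K)" for x
  proof (rule ccontr)
    assume "x \<notin> w ` I"
    then have "real K \<le> x" using below that(1) by (metis (mono_tags, lifting) mem_Collect_eq not_le)
    then have "of_int (int (m * K)) \<le> real m * x"
      by (simp add: mult_left_mono)
    then show False using alpha_floor_ge that(2) by (meson not_le)
  qed
  moreover have "w ` I \<subseteq> M" using below by auto
  ultimately have "floor_set \<alpha> m M \<inter> {..<int (m * K)} =
         (\<lambda>p. alpha_floor \<alpha> (real m * w p)) ` I \<inter> {..<int (m * K)}"
    by (fastforce simp: floor_set_def)
  also have "(\<lambda>p. alpha_floor \<alpha> (real m * w p)) ` I =
      (\<lambda>p. case t p of (e, r) \<Rightarrow> if snd (t q) < r then e + 1 else e) ` I"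
    using tab q \<alpha> by (intro image_cong) (auto simp: tabulated_def split: prod.splits)
  finally show ?thesis by (auto simp: truncation_def I[symmetric])
qed

lemma ex_threshold_of_alpha:
  assumes tab: "tabulated (set ps) (\<lambda>p. real m * w p) t"
    and below: "{x \<in> M. x < real K} = w ` set ps"
    and "0 \<in> w ` set ps" and "\<alpha> \<in> {0..1}"
  shows "\<exists>c\<in>set (map (snd \<circ> t) ps).
    floor_set \<alpha> m M \<inter> {..<int (m * K)} = set (truncation (int (m * K)) (map t ps) c)"
proof -
  let ?Y = "(\<lambda>p. real m * w p) ` set ps"
  have "\<exists>z\<in>?Y. \<forall>y\<in>?Y. alpha_floor \<alpha> y = \<lfloor>y\<rfloor> + of_bool (frac z < frac y)"
    using assms(3,4) by (intro alpha_floor_on_finite[where y\<^sub>0 = 0]) force+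
  then show ?thesis
    using floor_set_below[OF tab refl below] by fastforce
qed

lemma ex_alpha_of_threshold:
  assumes tab: "tabulated (set ps) (\<lambda>p. real m * w p) t"
    and below: "{x \<in> M. x < real K} = w ` set ps"
    and "q \<in> set ps"
  shows "\<exists>\<alpha>\<in>{0..1}.
    floor_set \<alpha> m M \<inter> {..<int (m * K)} = set (truncation (int (m * K)) (map t ps) (snd (t q)))"
  using threshold_realised[of "(\<lambda>p. real m * w p) ` set ps" "real m * w q"]
    floor_set_below[OF tab refl below _ assms(3)] by fastforce

section \<open>The logarithmic monoid\<close>

lemma logarithmic_monoid_below:
  "{x \<in> logarithmic_monoid. x < real K} = (\<lambda>i. log 2 (of_int i)) ` set [1..2 ^ K - 1]"
proof -
  have *: "log 2 (real i) < real K \<longleftrightarrow> int i \<le> 2 ^ K - 1" if "i \<ge> 1" for i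
  proof -
    have "log 2 (real i) < real K \<longleftrightarrow> real i < real (2 ^ K)"
      using that by (simp add: log_less_iff powr_realpow)
    also have "\<dots> \<longleftrightarrow> int i < int (2 ^ K)"
      unfolding of_nat_less_iff ..
    finally show ?thesis by simp
  qed
  show ?thesis
  proof safe
    fix x assume "x \<in> logarithmic_monoid" "x < real K"
    then obtain i :: nat where "i \<ge> 1" "x = log 2 (real i)" "int i \<le> 2 ^ K - 1"
      using * by (auto simp: logarithmic_monoid_def)
    then show "x \<in> (\<lambda>i. log 2 (of_int i)) ` set [1..2 ^ K - 1]"
      by (intro image_eqI[of _ _ "int i"]) auto
  next
    fix i :: int assume "i \<in> set [1..2 ^ K - 1]"
    then have "nat i \<ge> 1" "int (nat i) \<le> 2 ^ K - 1" "real_of_int i = real (nat i)" by auto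
    then show "log 2 (of_int i) \<in> logarithmic_monoid" "log 2 (of_int i) < real K"
      using *[of "nat i"] by (auto simp: logarithmic_monoid_def intro!: exI[of _ "nat i"])
  qed
qed

lemma logarithmic_monoid_nonneg: "x \<in> logarithmic_monoid \<Longrightarrow> 0 \<le> x"
  by (auto simp: logarithmic_monoid_def)

lemma logarithmic_monoid_succ: "x \<in> logarithmic_monoid \<Longrightarrow> x + 1 \<in> logarithmic_monoid"
proof -
  assume "x \<in> logarithmic_monoid"
  then obtain i :: nat where i: "i \<ge> 1" "x = log 2 (real i)" by (auto simp: logarithmic_monoid_def)
  then have "x + 1 = log 2 (real (2 * i))" by (simp add: log_mult)
  then show ?thesis using i unfolding logarithmic_monoid_def
    by (intro CollectI exI[of _ "2 * i"]) auto
qed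

text \<open>
  Doubling \<open>n\<close> until it reaches the binade $[N, 2N)$, while the exponent \<open>e\<close> counts down. The first
  argument bounds the number of steps.
\<close>

fun normalise :: "nat \<Rightarrow> int \<Rightarrow> int \<Rightarrow> int \<Rightarrow> int \<times> int" where
  "normalise 0 N e n = (e, n)"
| "normalise (Suc k) N e n = (if n < N then normalise k N (e - 1) (2 * n) else (e, n))"

lemma normalise:
  assumes "N \<le> 2 ^ k * n" "n < 2 * N"
  shows "\<exists>j. normalise k N e n = (e - int j, 2 ^ j * n) \<and> N \<le> 2 ^ j * n \<and> 2 ^ j * n < 2 * N"
  using assms
proof (induction k arbitrary: e n)
  case 0
  then show ?case by (intro exI[of _ 0]) simp
next
  case (Suc k)
  show ?case
  proof (cases "n < N")
    case True
    with Suc obtain j where "normalise k N (e - 1) (2 * n) = (e - 1 - int j, 2 ^ j * (2 * n))"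
      "N \<le> 2 ^ j * (2 * n)" "2 ^ j * (2 * n) < 2 * N"
      using Suc.IH[of "2 * n" "e - 1"] by (auto simp: mult_ac)
    then show ?thesis using True by (intro exI[of _ "Suc j"]) (simp add: mult_ac)
  next
    case False
    then show ?thesis using Suc.prems by (intro exI[of _ 0]) simp
  qed
qed

text \<open>
  The integer part of \<open>m * log 2 i\<close> is the binary exponent of $i^m$, and its fractional part is the
  logarithm of the mantissa; so the mantissas, scaled to integers in
  $[2^{mK}, 2^{mK+1})$, serve as keys.
\<close>

definition log_entry :: "nat \<Rightarrow> nat \<Rightarrow> int \<Rightarrow> int \<times> int" where
  "log_entry m K i = normalise (m * K) (2 ^ (m * K)) (int (m * K)) (i ^ m)"

lemma log_entry:
  assumes "1 \<le> i" "i < 2 ^ K"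
  shows "fst (log_entry m K i) = \<lfloor>real m * log 2 i\<rfloor>"
    and "frac (real m * log 2 i) = log 2 (snd (log_entry m K i)) - real (m * K)"
    and "snd (log_entry m K i) > 0"
proof -
  let ?T = "m * K"
  have im: "1 \<le> i ^ m" using assms by simp
  have "i ^ m \<le> (2 ^ K) ^ m" using assms by (intro power_mono) auto
  then have "i ^ m \<le> 2 ^ ?T" by (simp add: power_mult[symmetric] mult.commute)
  moreover have "(2::int) ^ ?T \<le> 2 ^ ?T * i ^ m" using im by simp
  ultimately obtain j where j: "log_entry m K i = (int ?T - int j, 2 ^ j * i ^ m)"
    "2 ^ ?T \<le> 2 ^ j * i ^ m" "2 ^ j * i ^ m < 2 * 2 ^ ?T"
    using normalise[of "2 ^ ?T" ?T "i ^ m" "int ?T"] unfolding log_entry_def by fastforce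
  then show pos: "snd (log_entry m K i) > 0" using im by simp
  have eq: "log 2 (snd (log_entry m K i)) = real j + real m * log 2 i"
    using assms j(1) by (simp add: log_mult log_nat_power)
  let ?r = "snd (log_entry m K i)"
  have "real_of_int (2 ^ ?T) \<le> of_int ?r" "real_of_int ?r < of_int (2 * 2 ^ ?T)"
    unfolding of_int_le_iff of_int_less_iff using j by simp_all
  then have "2 powr real ?T \<le> ?r" "?r < 2 powr (real ?T + 1)"
    by (simp_all add: powr_add powr_realpow del: of_nat_mult)
  then have bounds: "real ?T \<le> log 2 ?r" "log 2 ?r < real ?T + 1"
    using pos by (simp_all only: le_log_iff log_less_iff)
  show fl: "fst (log_entry m K i) = \<lfloor>real m * log 2 i\<rfloor>"
    using bounds eq j(1) by (intro floor_unique[symmetric]) auto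
  show "frac (real m * log 2 i) = log 2 ?r - real ?T"
    using eq j(1) by (simp add: frac_def fl[symmetric])
qed

definition log_table :: "nat \<Rightarrow> nat \<Rightarrow> (int \<times> int) list" where
  "log_table m K = map (log_entry m K) [1..2 ^ K - 1]"

lemma tabulated_log:
  "tabulated (set [1..2 ^ K - 1]) (\<lambda>i. real m * log 2 (of_int i)) (log_entry m K)"
  unfolding tabulated_def using log_entry[of _ K m] by simp

section \<open>The golden fractal monoid\<close>

text \<open>
  One refinement step of the golden fractal: \<open>f\<close> places a new point between any two
  neighbours.
\<close>

fun interleave :: "('a \<Rightarrow> 'a \<Rightarrow> 'a) \<Rightarrow> 'a list \<Rightarrow> 'a list" where
  "interleave f (x # y # xs) = x # f x y # interleave f (y # xs)"
| "interleave f xs = xs"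

lemma length_interleave: "length (interleave f xs) = 2 * length xs - 1"
  by (induction f xs rule: interleave.induct) auto

lemma interleave_eq_Nil_iff [simp]: "interleave f xs = [] \<longleftrightarrow> xs = []"
  by (induction f xs rule: interleave.induct) auto

lemma hd_interleave [simp]: "hd (interleave f xs) = hd xs"
  by (induction f xs rule: interleave.induct) auto

lemma last_interleave [simp]: "last (interleave f xs) = last xs"
  by (induction f xs rule: interleave.induct) auto

lemma map_interleave:
  assumes "\<And>x y. h (f x y) = g (h x) (h y)"
  shows "map h (interleave f xs) = interleave g (map h xs)"
  using assms by (induction f xs rule: interleave.induct) auto

lemma set_butlast_interleave:
  "set (butlast (interleave f xs)) =
     (\<Union>r<length xs - 1. {xs ! r, f (xs ! r) (xs ! Suc r)})"
proof (induction f xs rule: interleave.induct)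
  case (1 f x y xs)
  have "(\<Union>r<length (x # y # xs) - 1. {(x # y # xs) ! r, f ((x # y # xs) ! r) ((x # y # xs) ! Suc r)}) =
    {x, f x y} \<union> (\<Union>r<length (y # xs) - 1. {(y # xs) ! r, f ((y # xs) ! r) ((y # xs) ! Suc r)})"
    by (simp add: lessThan_Suc_eq_insert_0)
  then show ?case using 1 by simp
qed auto

lemma sorted_interleave:
  fixes xs :: "'a :: linorder list"
  assumes "\<And>x y. x < y \<Longrightarrow> x < f x y \<and> f x y < y" "sorted_wrt (<) xs"
  shows "sorted_wrt (<) (interleave f xs)"
  using assms
proof (induction f xs rule: interleave.induct)
  case (1 f x y xs)
  then have s: "sorted_wrt (<) (interleave f (y # xs))" by auto
  have "hd (interleave f (y # xs)) = y" by simp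
  then obtain zs where zs: "interleave f (y # xs) = y # zs"
    by (metis interleave_eq_Nil_iff list.collapse list.distinct(1))
  have "x < f x y" "f x y < y" using 1 by auto
  then show ?case using s by (auto simp: zs)
qed auto

abbreviation \<psi> :: real where "\<psi> \<equiv> golden_ratio - 1"

lemma psi_square: "\<psi> * \<psi> = 1 - \<psi>"
  by (simp add: golden_ratio_def field_simps)

text \<open>
  The bounds are quotients of consecutive Fibonacci numbers.
\<close>

lemma psi_bounds: "2584 / 4181 < \<psi>" "\<psi> < 1597 / 2584"
proof -
  have "9349 / 4181 < sqrt (5::real)"
    by (rule real_less_rsqrt) (simp add: power2_eq_square)
  moreover have "sqrt (5::real) < 5778 / 2584"
    by (rule real_less_lsqrt) (simp_all add: power2_eq_square)
  ultimately show "2584 / 4181 < \<psi>" "\<psi> < 1597 / 2584"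
    by (simp_all add: golden_ratio_def)
qed

text \<open>
  The offsets lie in the ring generated by \<open>\<psi>\<close>, so that pairs of integers represent them
  exactly.
\<close>

definition golden_value :: "int \<times> int \<Rightarrow> real" where
  "golden_value p = of_int (fst p) + of_int (snd p) * \<psi>"

text \<open>
  The new point \<open>p + \<psi> * (q - p)\<close>, expanded with \<open>\<psi> * \<psi> = 1 - \<psi>\<close>.
\<close>

definition golden_point :: "int \<times> int \<Rightarrow> int \<times> int \<Rightarrow> int \<times> int" where
  "golden_point p q = (case p of (a, b) \<Rightarrow> case q of (c, d) \<Rightarrow> (a + d - b, 2 * b + c - a - d))"

lemma golden_value_point:
  "golden_value (golden_point p q) = golden_value p + \<psi> * (golden_value q - golden_value p)"
proof -
  obtain a b c d where "p = (a, b)" "q = (c, d)" by force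
  moreover have "of_int (d - b) * \<psi> * \<psi> = of_int (d - b) * (1 - \<psi>)"
    using psi_square by (simp add: mult.assoc del: of_int_diff)
  ultimately show ?thesis by (simp add: golden_point_def golden_value_def algebra_simps)
qed

text \<open>
  The grid of level \<open>k\<close> consists of the offsets of the \<open>k\<close>-th period together with the conventional
  last value \<open>1\<close>; the offsets proper are obtained by \<open>butlast\<close>.
\<close>

fun golden_grid :: "nat \<Rightarrow> (int \<times> int) list" where
  "golden_grid 0 = [(0, 0), (1, 0)]"
| "golden_grid (Suc k) = interleave golden_point (golden_grid k)"

abbreviation golden_offsets :: "nat \<Rightarrow> real list" where
  "golden_offsets k \<equiv> map golden_value (golden_grid k)"

lemma golden_offsets_Suc:
  "golden_offsets (Suc k) = interleave (\<lambda>x y. x + \<psi> * (y - x)) (golden_offsets k)"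
  by (simp add: map_interleave golden_value_point)

lemma length_golden_grid: "length (golden_grid k) = 2 ^ k + 1"
  by (induction k) (simp_all add: length_interleave)

lemma golden_grid_ends: "hd (golden_grid k) = (0, 0)" "last (golden_grid k) = (1, 0)" "golden_grid k \<noteq> []"
  by (induction k) simp_all

lemma sorted_golden_offsets: "sorted_wrt (<) (golden_offsets k)"
proof (induction k)
  case 0
  then show ?case by (simp add: golden_value_def)
next
  case (Suc k)
  have "x < x + \<psi> * (y - x) \<and> x + \<psi> * (y - x) < y" if "x < y" for x y :: real
  proof -
    have "0 < \<psi> * (y - x)" "0 < (1 - \<psi>) * (y - x)" using that psi_bounds by simp_all
    then show ?thesis by (simp add: algebra_simps)
  qed
  then show ?case unfolding golden_offsets_Suc by (intro sorted_interleave Suc.IH)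
qed

lemma golden_offsets_split: "golden_offsets k = butlast (golden_offsets k) @ [1]"
proof -
  have "last (golden_offsets k) = 1" "golden_offsets k \<noteq> []"
    using golden_grid_ends[of k] by (simp_all add: last_map golden_value_def)
  then show ?thesis by (metis append_butlast_last_id)
qed

lemma golden_offsets_range:
  assumes "x \<in> set (butlast (golden_offsets k))" shows "0 \<le> x" "x < 1"
proof -
  have s: "sorted_wrt (<) (butlast (golden_offsets k) @ [1])"
    using sorted_golden_offsets[of k] golden_offsets_split[of k] by simp
  then show "x < 1" using assms by (simp add: sorted_wrt_append)
  have "hd (golden_offsets k) = 0" "golden_offsets k \<noteq> []"
    using golden_grid_ends[of k] by (simp_all add: hd_map golden_value_def)
  then obtain ys where ys: "golden_offsets k = 0 # ys" by (cases "golden_offsets k") auto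
  have "x \<in> set (golden_offsets k)" using assms by (rule in_set_butlastD)
  then show "0 \<le> x" using sorted_golden_offsets[of k] by (auto simp: ys simp del: list.map)
qed

lemma golden_offsets_mono:
  "set (butlast (golden_offsets k)) \<subseteq> set (butlast (golden_offsets (Suc k)))"
proof
  fix x assume "x \<in> set (butlast (golden_offsets k))"
  then obtain r where "r < length (golden_offsets k) - 1" "x = golden_offsets k ! r"
    by (metis in_set_conv_nth length_butlast nth_butlast)
  then show "x \<in> set (butlast (golden_offsets (Suc k)))"
    unfolding golden_offsets_Suc set_butlast_interleave by blast
qed

lemma golden_period_eq:
  "golden_period (Suc k) = (\<lambda>x. real (Suc k) + x) ` set (butlast (golden_offsets (Suc k)))"
proof (induction k)
  case 0
  show ?case by (simp add: golden_point_def golden_value_def)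
next
  case (Suc k)
  let ?i = "Suc k" and ?xs = "butlast (golden_offsets (Suc k))"
  have "(\<lambda>x. x - real ?i) ` golden_period ?i = set ?xs"
    by (simp only: Suc.IH image_image) simp
  moreover have "sorted_wrt (<) ?xs"
    using sorted_golden_offsets[of ?i] by (subst (asm) golden_offsets_split) (simp only: sorted_wrt_append)
  ultimately have "sorted_list_of_set ((\<lambda>x. x - real ?i) ` golden_period ?i) = ?xs"
    by (simp only: sorted_list_of_set.idem_if_sorted_distinct strict_sorted_iff)
  then have tau: "golden_tau ?i (golden_period ?i) r = golden_offsets ?i ! r" for r
    unfolding golden_tau_def using golden_offsets_split[of ?i] by simp
  have "{0..N - 1} = {..<N}" if "0 < N" for N :: nat
    using that by auto
  then have "{0..2 ^ ?i - 1} = {..<length (golden_offsets ?i) - (1::nat)}"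
    unfolding length_map length_golden_grid by simp
  then show ?case
    unfolding golden_period.simps Let_def tau golden_offsets_Suc[of ?i] set_butlast_interleave image_UN
    by (simp add: add.assoc)
qed

text \<open>
  The level \<open>0\<close> grid contributes exactly the isolated element \<open>0\<close> of the monoid, so that
  all levels can be treated alike.
\<close>

lemma golden_fractal_monoid_eq:
  "golden_fractal_monoid = (\<Union>s. (\<lambda>x. real s + x) ` set (butlast (golden_offsets s)))"
proof -
  have UN_Suc: "(\<Union>s. f s) = f 0 \<union> (\<Union>k. f (Suc k))" for f :: "nat \<Rightarrow> real set"
    by (auto, metis not0_implies_Suc)
  have "{1..} = range Suc" by (auto simp: image_iff Suc_le_eq gr0_conv_Suc)
  then have "golden_fractal_monoid = {0} \<union> (\<Union>k. golden_period (Suc k))"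
    by (simp add: golden_fractal_monoid_def)
  also have "{0} = (\<lambda>x. real 0 + x) ` set (butlast (golden_offsets 0))"
    by (simp add: golden_value_def)
  finally show ?thesis unfolding golden_period_eq UN_Suc[of "\<lambda>s. (\<lambda>x. real s + x) ` _ s"] .
qed

lemma golden_fractal_monoid_succ:
  assumes "x \<in> golden_fractal_monoid" shows "x + 1 \<in> golden_fractal_monoid"
proof -
  obtain s y where "y \<in> set (butlast (golden_offsets s))" "x = real s + y"
    using assms by (auto simp: golden_fractal_monoid_eq)
  then have "y \<in> set (butlast (golden_offsets (Suc s)))" "x + 1 = real (Suc s) + y"
    using golden_offsets_mono by (blast, simp)
  then show ?thesis unfolding golden_fractal_monoid_eq by blast
qed

text \<open>An index \<open>(s, a, b)\<close> stands for the element \<open>s + a + b * \<psi>\<close> of period \<open>s\<close>.\<close>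

definition golden_indices :: "nat \<Rightarrow> (int \<times> int \<times> int) list" where
  "golden_indices K = concat (map (\<lambda>s. map (Pair (int s)) (butlast (golden_grid s))) [0..<K])"

definition golden_element :: "int \<times> int \<times> int \<Rightarrow> real" where
  "golden_element p = of_int (fst p) + golden_value (snd p)"

lemma golden_fractal_monoid_below:
  "{x \<in> golden_fractal_monoid. x < real K} = golden_element ` set (golden_indices K)"
proof -
  have "{x \<in> golden_fractal_monoid. x < real K} =
      (\<Union>s<K. (\<lambda>x. real s + x) ` set (butlast (golden_offsets s)))"
  proof safe
    fix x assume "x \<in> golden_fractal_monoid" "x < real K"
    then obtain s y where y: "y \<in> set (butlast (golden_offsets s))" "x = real s + y"
      by (auto simp: golden_fractal_monoid_eq)
    then have "s < K" using golden_offsets_range(1)[OF y(1)] \<open>x < real K\<close> by linarith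
    then show "x \<in> (\<Union>s<K. (\<lambda>x. real s + x) ` set (butlast (golden_offsets s)))" using y by blast
  next
    fix s y assume y: "s < K" "y \<in> set (butlast (golden_offsets s))"
    then show "real s + y \<in> golden_fractal_monoid" by (auto simp: golden_fractal_monoid_eq)
    show "real s + y < real K" using golden_offsets_range(2)[OF y(2)] y(1) by linarith
  qed
  also have "\<dots> = golden_element ` set (golden_indices K)"
    by (simp add: golden_indices_def golden_element_def image_UN image_image lessThan_atLeast0
        flip: map_butlast del: golden_grid.simps)
  finally show ?thesis .
qed

text \<open>
  Modulo integers, a multiple of a monoid element is a multiple \<open>n * \<psi>\<close>. The number \<open>\<psi>\<close>
  differs from \<open>1597 / 2584\<close> by at most \<open>1 / (4181 * 2584)\<close>, so for \<open>\<bar>n\<bar> < 2584 / 2\<close> replacing one by the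
  other moves \<open>n * \<psi>\<close> by less than half of the spacing \<open>1 / 2584\<close> of the
  approximating fractions.
\<close>

lemma psi_multiple:
  assumes "\<bar>n\<bar> < 1292"
  shows "\<lfloor>of_int n * \<psi>\<rfloor> = n * 1597 div 2584"
    and "\<bar>frac (of_int n * \<psi>) - of_int (n * 1597 mod 2584) / 2584\<bar> < 1 / (2 * 2584)"
proof -
  define q r where "q = n * 1597 div 2584" and "r = n * 1597 mod 2584"
  have "n * 1597 = 2584 * q + r" by (simp add: q_def r_def)
  then have qr: "real_of_int n * 1597 = 2584 * of_int q + of_int r"
    by (metis of_int_add of_int_mult of_int_numeral)
  have "\<bar>\<psi> - 1597 / 2584\<bar> \<le> 1 / (4181 * 2584)" using psi_bounds by (auto simp: abs_le_iff)
  then have "\<bar>of_int n\<bar> * \<bar>\<psi> - 1597 / 2584\<bar> \<le> 1292 * (1 / (4181 * 2584))"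
    using assms by (intro mult_mono) auto
  moreover have "of_int n * \<psi> - (of_int q + of_int r / 2584) = of_int n * (\<psi> - 1597 / 2584)"
    using qr by (simp add: algebra_simps)
  ultimately have err: "\<bar>of_int n * \<psi> - (of_int q + of_int r / 2584)\<bar> < 1 / (2 * 2584)"
    by (simp add: abs_mult)
  have "of_int q \<le> of_int n * \<psi> \<and> of_int n * \<psi> < of_int q + (1::real)"
  proof (cases "n = 0")
    case True
    then show ?thesis by (simp add: q_def)
  next
    case False
    have "r \<noteq> 0"
    proof
      assume "r = 0"
      then have "2584 dvd n * 1597" by (simp add: r_def mod_eq_0_iff_dvd)
      moreover have "coprime 2584 (1597::int)" by code_simp
      ultimately have "2584 dvd n" by (simp add: coprime_dvd_mult_left_iff)
      then show False using False assms dvd_imp_le_int[of n 2584] by simp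
    qed
    moreover have "0 \<le> r" "r < 2584" by (simp_all add: r_def)
    ultimately have "1 \<le> r" "r \<le> 2583" by simp_all
    then have "1 \<le> real_of_int r" "real_of_int r \<le> 2583" by simp_all
    then show ?thesis using err unfolding abs_less_iff by simp
  qed
  then have fl: "\<lfloor>of_int n * \<psi>\<rfloor> = q" by (intro floor_unique) auto
  then show "\<lfloor>of_int n * \<psi>\<rfloor> = n * 1597 div 2584" by (simp add: q_def)
  show "\<bar>frac (of_int n * \<psi>) - of_int (n * 1597 mod 2584) / 2584\<bar> < 1 / (2 * 2584)"
    using err by (simp add: frac_def fl r_def[symmetric] diff_diff_eq)
qed

text \<open>
  Distinct residues put the approximations at least \<open>1 / 2584\<close> apart, which exceeds both errors
  together; equal residues force \<open>n = n'\<close>, since \<open>1597\<close> is invertible modulo \<open>2584\<close> and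
  \<open>\<bar>n - n'\<bar> < 2584\<close>.
\<close>

lemma frac_psi_less_iff:
  assumes "\<bar>n\<bar> < 1292" "\<bar>n'\<bar> < 1292"
  shows "frac (of_int n * \<psi>) < frac (of_int n' * \<psi>) \<longleftrightarrow> n * 1597 mod 2584 < n' * 1597 mod 2584"
proof -
  have less: "frac (of_int k * \<psi>) < frac (of_int l * \<psi>)"
    if "\<bar>k\<bar> < 1292" "\<bar>l\<bar> < 1292" "k * 1597 mod 2584 < l * 1597 mod 2584" for k l
  proof -
    have "real_of_int (k * 1597 mod 2584) + 1 \<le> of_int (l * 1597 mod 2584)"
      using that(3) by linarith
    then show ?thesis using psi_multiple(2)[OF that(1)] psi_multiple(2)[OF that(2)]
      unfolding abs_less_iff by (simp add: field_simps)
  qed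
  have "n = n'" if "n * 1597 mod 2584 = n' * 1597 mod 2584"
  proof -
    have "2584 dvd (n - n') * 1597" using that by (simp add: mod_eq_dvd_iff left_diff_distrib)
    moreover have "coprime 2584 (1597::int)" by code_simp
    ultimately have "2584 dvd n - n'" by (metis coprime_dvd_mult_left_iff)
    then obtain j where "n - n' = 2584 * j" ..
    moreover from this have "j = 0" using assms by linarith
    ultimately show ?thesis by simp
  qed
  then show ?thesis
    using less[OF assms] less[OF assms(2,1)]
    by (cases rule: linorder_cases[of "n * 1597 mod 2584" "n' * 1597 mod 2584"]) simp_all
qed

definition golden_entry :: "nat \<Rightarrow> int \<times> int \<times> int \<Rightarrow> int \<times> int" where
  "golden_entry m p = (case p of (s, a, b) \<Rightarrow> let n = int m * b * 1597 in
     (int m * (s + a) + n div 2584, n mod 2584))"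

definition golden_table :: "nat \<Rightarrow> nat \<Rightarrow> (int \<times> int) list" where
  "golden_table m K = map (golden_entry m) (golden_indices K)"

lemma tabulated_golden:
  assumes "\<And>s a b. (s, a, b) \<in> set (golden_indices K) \<Longrightarrow> int m * \<bar>b\<bar> < 1292"
  shows "tabulated (set (golden_indices K)) (\<lambda>p. real m * golden_element p) (golden_entry m)"
proof -
  have split: "real m * golden_element (s, a, b) = of_int (int m * (s + a)) + of_int (int m * b) * \<psi>" for s a b
    by (simp add: golden_element_def golden_value_def algebra_simps)
  have frac: "frac (real m * golden_element (s, a, b)) = frac (of_int (int m * b) * \<psi>)" for s a b
    unfolding split by (simp add: frac_def del: of_int_mult)
  have floor: "\<lfloor>real m * golden_element (s, a, b)\<rfloor> = int m * (s + a) + \<lfloor>of_int (int m * b) * \<psi>\<rfloor>" for s a b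
    unfolding split by (simp del: of_int_mult)
  have bound: "\<bar>int m * b\<bar> < 1292" if "(s, a, b) \<in> set (golden_indices K)" for s a b
    using assms[OF that] by (simp add: abs_mult)
  show ?thesis
    unfolding tabulated_def
  proof (intro conjI ballI)
    fix p assume "p \<in> set (golden_indices K)"
    moreover obtain s a b where "p = (s, a, b)" by (cases p)
    ultimately show "fst (golden_entry m p) = \<lfloor>real m * golden_element p\<rfloor>"
      using bound by (simp only: floor psi_multiple(1)) (simp add: golden_entry_def Let_def)
  next
    fix p q assume "p \<in> set (golden_indices K)" "q \<in> set (golden_indices K)"
    moreover obtain s a b where "p = (s, a, b)" by (cases p)
    moreover obtain s' a' b' where "q = (s', a', b')" by (cases q)
    ultimately show "frac (real m * golden_element p) < frac (real m * golden_element q) \<longleftrightarrow>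
        snd (golden_entry m p) < snd (golden_entry m q)"
      using bound by (simp only: frac frac_psi_less_iff) (simp add: golden_entry_def Let_def)
  qed
qed

text \<open>Coefficients in the first levels are small enough for \<open>tabulated_golden\<close> when \<open>m\<close> is small.\<close>

lemma golden_indices_bound:
  assumes "(s, a, b) \<in> set (golden_indices K)"
  shows "K \<le> 5 \<Longrightarrow> \<bar>b\<bar> \<le> 21" and "K \<le> 6 \<Longrightarrow> \<bar>b\<bar> \<le> 55"
proof -
  have "list_all (\<lambda>k. list_all (\<lambda>(a, b). \<bar>b\<bar> \<le> 21) (golden_grid k)) [0..<5]"
    "list_all (\<lambda>k. list_all (\<lambda>(a, b). \<bar>b\<bar> \<le> 55) (golden_grid k)) [0..<6]"
    by code_simp+
  moreover obtain k where "k < K" "(a, b) \<in> set (golden_grid k)"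
    using assms by (auto simp: golden_indices_def dest: in_set_butlastD)
  ultimately show "K \<le> 5 \<Longrightarrow> \<bar>b\<bar> \<le> 21" and "K \<le> 6 \<Longrightarrow> \<bar>b\<bar> \<le> 55"
    by (fastforce simp: list_all_iff)+
qed

section \<open>Large multiplicities\<close>

text \<open>The bound \<open>2 + 2 * \<psi>\<close> is the second element $3 + \psi^3$ of the third period.\<close>

lemma golden_gap:
  assumes "y \<in> golden_fractal_monoid" shows "y \<le> 3 \<or> 2 + 2 * \<psi> \<le> y"
proof -
  obtain s x where x: "x \<in> set (butlast (golden_offsets s))" "y = real s + x"
    using assms by (auto simp: golden_fractal_monoid_eq)
  consider "s \<le> 2" | "s = 3" | "4 \<le> s" by linarith
  then show ?thesis
  proof cases
    case 2
    have "golden_grid 3 = [(0, 0), (- 1, 2), (1, - 1), (3, - 4), (0, 1), (2, - 2), (- 1, 3), (- 4, 8), (1, 0)]"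
      by code_simp
    then show ?thesis using x 2 psi_bounds by (auto simp: golden_value_def)
  next
    case 1 then show ?thesis using golden_offsets_range[OF x(1)] x(2) by linarith
  next
    case 3
    then have "4 \<le> y" using golden_offsets_range(1)[OF x(1)] x(2) by simp
    moreover have "2 + 2 * \<psi> \<le> 4" using psi_bounds(2) by simp
    ultimately show ?thesis by simp
  qed
qed

text \<open>
  The two roundings of \<open>m * log 2 9\<close> and of a preimage \<open>m * y\<close> of the same integer put \<open>y\<close> within
  \<open>2 / m\<close> of \<open>log 2 9\<close>, inside the gap.
\<close>

lemma discretizations_differ:
  assumes "31 \<le> m"
  shows "floor_set \<alpha> m logarithmic_monoid \<noteq> floor_set \<beta> m golden_fractal_monoid"
proof
  assume eq: "floor_set \<alpha> m logarithmic_monoid = floor_set \<beta> m golden_fractal_monoid"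
  let ?x = "log 2 (real 9)"
  have "alpha_floor \<alpha> (real m * ?x) \<in> floor_set \<alpha> m logarithmic_monoid"
    unfolding floor_set_def logarithmic_monoid_def by fastforce
  then obtain y where y: "y \<in> golden_fractal_monoid"
    "alpha_floor \<alpha> (real m * ?x) = alpha_floor \<beta> (real m * y)"
    unfolding eq by (auto simp: floor_set_def)
  have "\<bar>real m * ?x - real m * y\<bar> < 2"
    using alpha_floor_near[of \<alpha> "real m * ?x"] alpha_floor_near[of \<beta> "real m * y"] y(2) by linarith
  then have "real m * \<bar>?x - y\<bar> < 2" by (simp add: abs_mult flip: right_diff_distrib)
  moreover have "31 * \<bar>?x - y\<bar> \<le> real m * \<bar>?x - y\<bar>"
    using assms by (intro mult_right_mono) auto
  ultimately have near: "\<bar>?x - y\<bar> < 2 / 31" by simp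
  \<comment> \<open>Rational bounds on \<open>log 2 9\<close> that keep it more than $2 / 31$ away from both ends of the gap.\<close>
  have "log 2 (2 ^ 31) < log 2 (9 ^ 10 :: real)" "log 2 (9 ^ 41 :: real) < log 2 (2 ^ 130)"
    by simp_all
  moreover have "log 2 (2 ^ n) = real n" "log 2 (9 ^ n) = real n * ?x" for n
    by (simp_all add: log_nat_power)
  ultimately have "real 31 < real 10 * ?x" "real 41 * ?x < real 130"
    by (simp_all only:)
  then have "31 / 10 < ?x" "?x < 130 / 41" by simp_all
  then show False using near golden_gap[OF y(1)] psi_bounds by (auto simp: abs_less_iff)
qed

section \<open>Excluding the other small multiplicities\<close>

lemma zero_in_tables:
  assumes "1 \<le> K"
  shows "0 \<in> (\<lambda>i. log 2 (of_int i)) ` set [1..2 ^ K - 1]"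
    and "0 \<in> golden_element ` set (golden_indices K)"
proof -
  have "(1::int) \<le> 2 ^ K - 1" using power_increasing[OF assms, of "2::int"] by simp
  then show "0 \<in> (\<lambda>i. log 2 (of_int i)) ` set [1..2 ^ K - 1]"
    by (intro image_eqI[of _ _ 1]) simp_all
  have "(0, 0, 0) \<in> set (golden_indices K)"
    using assms by (auto simp: golden_indices_def intro!: bexI[of _ 0])
  then show "0 \<in> golden_element ` set (golden_indices K)"
    by (intro image_eqI[of _ _ "(0, 0, 0)"]) (simp_all add: golden_element_def golden_value_def)
qed

definition closed_below :: "int \<Rightarrow> int list \<Rightarrow> bool" where
  "closed_below N xs \<longleftrightarrow> (\<forall>x\<in>set xs. \<forall>y\<in>set xs. x + y < N \<longrightarrow> x + y \<in> set xs)"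

text \<open>
  Passing the tables and truncations as arguments of separate functions makes rewriting evaluate
  each of them once, before the search.
\<close>

definition truncations :: "int \<Rightarrow> (int \<times> int) list \<Rightarrow> int list list" where
  "truncations N E = map (truncation N E) (remdups (map snd E))"

definition common_closed :: "int \<Rightarrow> int list list \<Rightarrow> int list list \<Rightarrow> bool" where
  "common_closed N Xs Ys \<longleftrightarrow> (\<exists>xs\<in>set Xs. xs \<in> set Ys \<and> closed_below N xs)"

text \<open>
  The necessary condition that remains of the problem when only integers below \<open>m * K\<close> are
  considered.
\<close>

definition common_truncation :: "nat \<Rightarrow> nat \<Rightarrow> bool" where
  "common_truncation m K \<longleftrightarrow> common_closed (int (m * K))
     (truncations (int (m * K)) (log_table m K)) (truncations (int (m * K)) (golden_table m K))"

lemma common_truncation_necessary: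
  assumes "\<alpha> \<in> {0..1}" "\<beta> \<in> {0..1}"
    and eq: "floor_set \<alpha> m logarithmic_monoid = floor_set \<beta> m golden_fractal_monoid"
    and S: "numerical_semigroup S" "int ` S = floor_set \<alpha> m logarithmic_monoid"
    and K: "1 \<le> K" "K \<le> 5" and "m \<le> 30"
  shows "common_truncation m K"
proof -
  let ?N = "int (m * K)"
  obtain c where c: "c \<in> set (map snd (log_table m K))"
    "floor_set \<alpha> m logarithmic_monoid \<inter> {..<?N} = set (truncation ?N (log_table m K) c)"
    using ex_threshold_of_alpha[OF tabulated_log logarithmic_monoid_below zero_in_tables(1)[OF K(1)] assms(1)]
    unfolding log_table_def[symmetric] map_map[symmetric] by blast
  have "tabulated (set (golden_indices K)) (\<lambda>p. real m * golden_element p) (golden_entry m)"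
  proof (rule tabulated_golden)
    fix s a b assume "(s, a, b) \<in> set (golden_indices K)"
    then show "int m * \<bar>b\<bar> < 1292"
      using mult_mono[of "int m" 30 "\<bar>b\<bar>" 21] golden_indices_bound(1)[of s a b K] K(2) \<open>m \<le> 30\<close> by simp
  qed
  from ex_threshold_of_alpha[OF this golden_fractal_monoid_below zero_in_tables(2)[OF K(1)] assms(2)]
  obtain d where d: "d \<in> set (map snd (golden_table m K))"
    "floor_set \<beta> m golden_fractal_monoid \<inter> {..<?N} = set (truncation ?N (golden_table m K) d)"
    unfolding golden_table_def[symmetric] map_map[symmetric] by blast
  have "truncation ?N (log_table m K) c = truncation ?N (golden_table m K) d"
    unfolding truncation_eq_iff using c(2) d(2) eq by simp
  moreover have "closed_below ?N (truncation ?N (log_table m K) c)"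
    unfolding closed_below_def c(2)[symmetric] S(2)[symmetric]
    using S(1) by (auto simp: numerical_semigroup_def simp flip: of_nat_add)
  moreover have "truncation ?N (log_table m K) c \<in> set (truncations ?N (log_table m K))"
    "truncation ?N (golden_table m K) d \<in> set (truncations ?N (golden_table m K))"
    unfolding truncations_def set_map set_remdups using c(1) d(1) by (auto intro!: imageI)
  ultimately show ?thesis
    unfolding common_truncation_def common_closed_def by metis
qed

text \<open>
  Four octaves suffice, except for \<open>m = 15\<close> and \<open>m = 20\<close>, where the four-octave truncations still
  admit a solution.
\<close>

lemma no_common_truncation_11_to_21: "\<forall>m\<in>set [11, 14, 16, 17, 19, 21]. \<not> common_truncation m 4"
  by code_simp

lemma no_common_truncation_22_to_26: "\<forall>m\<in>set [22, 23, 24, 25, 26]. \<not> common_truncation m 4"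
  by code_simp

lemma no_common_truncation_27_to_30: "\<forall>m\<in>set [27, 28, 29, 30]. \<not> common_truncation m 4"
  by code_simp

lemma no_common_truncation_15: "\<not> common_truncation 15 5"
  by code_simp

lemma no_common_truncation_20: "\<not> common_truncation 20 5"
  by code_simp

lemma no_common_truncation:
  assumes "m \<in> set [11, 14, 15, 16, 17, 19, 20, 21, 22, 23, 24, 25, 26, 27, 28, 29, 30]"
  shows "\<not> common_truncation m 4 \<or> \<not> common_truncation m 5"
proof -
  have "m \<in> set [11, 14, 16, 17, 19, 21] \<or> m \<in> set [22, 23, 24, 25, 26] \<or>
      m \<in> set [27, 28, 29, 30] \<or> m = 15 \<or> m = 20"
    using assms unfolding list.set insert_iff empty_iff by argo
  then show ?thesis
    using no_common_truncation_11_to_21 no_common_truncation_22_to_26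
      no_common_truncation_27_to_30 no_common_truncation_15 no_common_truncation_20 by metis
qed

section \<open>Realising the remaining multiplicities\<close>

lemma floor_set_succ:
  assumes "\<And>x. x \<in> M \<Longrightarrow> x + 1 \<in> M" "n \<in> floor_set \<alpha> m M"
  shows "n + int m \<in> floor_set \<alpha> m M"
proof -
  obtain x where x: "x \<in> M" "n = alpha_floor \<alpha> (real m * x)" using assms(2) by (auto simp: floor_set_def)
  have "n + int m = alpha_floor \<alpha> (real m * (x + 1))"
    using alpha_floor_add_int[of \<alpha> "int m" "real m * x"] x(2) by (simp add: algebra_simps)
  then show ?thesis using assms(1)[OF x(1)] by (auto simp: floor_set_def)
qed

lemma mem_of_full_block:
  fixes A :: "int set"
  assumes "\<And>n. n \<in> A \<Longrightarrow> n + int m \<in> A" "{int (m * k)..<int (m * Suc k)} \<subseteq> A" "1 \<le> m" "int (m * k) \<le> n"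
  shows "n \<in> A"
proof -
  define q r where "q = (n - int (m * k)) div int m" and "r = (n - int (m * k)) mod int m"
  have n: "n = int (m * k) + r + q * int m" by (simp add: q_def r_def)
  have q: "0 \<le> q" using assms by (simp add: q_def pos_imp_zdiv_nonneg_iff)
  have "0 \<le> r" "r < int m" using assms by (simp_all add: r_def)
  then have r: "int (m * k) + r \<in> A" using assms(2) by (auto simp: algebra_simps)
  have "int (m * k) + r + int j * int m \<in> A" for j
  proof (induction j)
    case 0
    then show ?case using r by simp
  next
    case (Suc j)
    then show ?case using assms(1)[OF Suc.IH] by (simp add: algebra_simps)
  qed
  from this[of "nat q"] show ?thesis using n q by simp
qed

text \<open>
  Here the list \<open>xs\<close> is the truncation below \<open>N\<close>, and \<open>N'\<close> is the point from
  which everything is present, so that only sums below \<open>N'\<close> have to be checked.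
\<close>

definition certifies :: "int \<Rightarrow> int \<Rightarrow> int list \<Rightarrow> int list \<Rightarrow> bool" where
  "certifies N' N xs ys \<longleftrightarrow> xs = ys \<and> closed_below N' (filter (\<lambda>n. n < N') xs) \<and>
     (\<forall>n\<in>set [N'..N - 1]. n \<in> set xs)"

text \<open>
  Six periods are enough: for every multiplicity of the list the last of them can be filled
  completely.
\<close>

definition common_witness :: "nat \<Rightarrow> int \<Rightarrow> int \<times> int \<times> int \<Rightarrow> bool" where
  "common_witness m i p \<longleftrightarrow> i \<in> set [1..2 ^ 6 - 1] \<and> p \<in> set (golden_indices 6) \<and>
     certifies (int (m * 5)) (int (m * 6))
       (truncation (int (m * 6)) (log_table m 6) (snd (log_entry m 6 i)))
       (truncation (int (m * 6)) (golden_table m 6) (snd (golden_entry m p)))"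

lemma common_witness_sufficient:
  assumes w: "common_witness m i p" and m: "1 \<le> m" "m \<le> 18"
  shows "\<exists>\<alpha>\<in>{0..1}. \<exists>\<beta>\<in>{0..1}.
    floor_set \<alpha> m logarithmic_monoid = floor_set \<beta> m golden_fractal_monoid \<and>
    (\<exists>S. numerical_semigroup S \<and> int ` S = floor_set \<alpha> m logarithmic_monoid)"
proof -
  let ?N = "int (m * 6)"
  define xs where "xs = truncation ?N (log_table m 6) (snd (log_entry m 6 i))"
  have i: "i \<in> set [1..2 ^ 6 - 1]" and p: "p \<in> set (golden_indices 6)"
    and eq: "xs = truncation ?N (golden_table m 6) (snd (golden_entry m p))"
    and closed: "closed_below (int (m * 5)) (filter (\<lambda>n. n < int (m * 5)) xs)"
    and full: "{int (m * 5)..<?N} \<subseteq> set xs"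
    using w unfolding common_witness_def certifies_def xs_def[symmetric] by auto
  obtain \<alpha> where \<alpha>: "\<alpha> \<in> {0..1}" "floor_set \<alpha> m logarithmic_monoid \<inter> {..<?N} = set xs"
    using ex_alpha_of_threshold[OF tabulated_log logarithmic_monoid_below i, of m]
    unfolding log_table_def[symmetric] xs_def[symmetric] by blast
  have "tabulated (set (golden_indices 6)) (\<lambda>p. real m * golden_element p) (golden_entry m)"
  proof (rule tabulated_golden)
    fix s a b assume "(s, a, b) \<in> set (golden_indices 6)"
    then show "int m * \<bar>b\<bar> < 1292"
      using mult_mono[of "int m" 18 "\<bar>b\<bar>" 55] golden_indices_bound(2)[of s a b 6] m by simp
  qed
  from ex_alpha_of_threshold[OF this golden_fractal_monoid_below p]
  obtain \<beta> where "\<beta> \<in> {0..1}" "floor_set \<beta> m golden_fractal_monoid \<inter> {..<?N} =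
      set (truncation ?N (golden_table m 6) (snd (golden_entry m p)))"
    unfolding golden_table_def[symmetric] by blast
  then have \<beta>: "\<beta> \<in> {0..1}" "floor_set \<beta> m golden_fractal_monoid \<inter> {..<?N} = set xs"
    using eq by simp_all
  let ?A = "floor_set \<alpha> m logarithmic_monoid" and ?B = "floor_set \<beta> m golden_fractal_monoid"
  have "{int (m * 5)..<int (m * Suc 5)} \<subseteq> ?A" "{int (m * 5)..<int (m * Suc 5)} \<subseteq> ?B"
    using full \<alpha>(2) \<beta>(2) by auto
  then have large: "n \<in> ?A" "n \<in> ?B" if "int (m * 5) \<le> n" for n
    using mem_of_full_block[OF floor_set_succ _ m(1) that] logarithmic_monoid_succ golden_fractal_monoid_succ
    by blast+
  have AB: "?A = ?B"
  proof (rule set_eqI)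
    fix n
    have "?A \<inter> {..<?N} = ?B \<inter> {..<?N}" using \<alpha>(2) \<beta>(2) by simp
    then show "n \<in> ?A \<longleftrightarrow> n \<in> ?B"
      using large[of n] by (cases "n < ?N") (auto simp: set_eq_iff)
  qed
  have nonneg: "0 \<le> n" if "n \<in> ?A" for n
    using that logarithmic_monoid_nonneg by (auto simp: floor_set_def intro!: alpha_floor_ge)
  define S where "S = {n. int n \<in> ?A}"
  have S: "int ` S = ?A"
    using nonneg by (force simp: S_def image_iff intro: exI[of _ "nat _"])
  have "alpha_floor \<alpha> (real m * log 2 (real 1)) \<in> ?A"
    unfolding floor_set_def logarithmic_monoid_def by fastforce
  then have "0 \<in> ?A" using alpha_floor_of_int[of \<alpha> 0] by simp
  moreover have "a + b \<in> ?A" if "a \<in> ?A" "b \<in> ?A" for a b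
  proof (cases "a + b < int (m * 5)")
    case True
    have "a < int (m * 5)" "b < int (m * 5)"
      using nonneg[OF that(1)] nonneg[OF that(2)] True by simp_all
    moreover from this have "a \<in> set xs" "b \<in> set xs"
      unfolding \<alpha>(2)[symmetric] using that by simp_all
    ultimately have "a + b \<in> set xs" using closed True unfolding closed_below_def by simp
    then show ?thesis unfolding \<alpha>(2)[symmetric] by simp
  next
    case False
    then show ?thesis by (intro large(1)) simp
  qed
  moreover have "UNIV - S \<subseteq> {..<m * 5}"
    using large by (auto simp: S_def not_le[symmetric])
  ultimately have "numerical_semigroup S"
    unfolding numerical_semigroup_def by (auto simp: S_def intro: finite_subset)
  then show ?thesis using \<alpha>(1) \<beta>(1) AB S by blast
qed

text \<open>
  In each tuple \<open>i\<close> gives the threshold \<open>log 2 i\<close>, and \<open>a + b * \<psi>\<close> is the threshold for the golden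
  monoid. Thresholds matter only modulo \<open>1\<close>, so the latter can be placed on level \<open>5\<close>,
  whose grid contains the grids of all lower levels.
\<close>

lemma common_witnesses:
  "\<forall>(m, i, a, b) \<in> set
     [(1, 1, 0, 0), (2, 1, 0, 0), (3, 1, 1, -1), (4, 1, 0, 0), (5, 1, -1, 2), (6, 1, 1, -1),
      (7, 1, 2, -3), (8, 1, 3, -4), (9, 1, 1, -1), (10, 1, 2, -3)].
     common_witness m i (5, a, b)"
  by code_simp

lemma common_witness_12: "common_witness 12 17 (5, 4, -5)"
  by code_simp

lemma common_witness_13: "common_witness 13 1 (5, 3, -4)"
  by code_simp

lemma common_witness_18: "common_witness 18 1 (5, 6, -9)"
  by code_simp

section \<open>The classification\<close>

lemma multiplicity_of_log_discretization:
  assumes "1 \<le> m" "int ` S = floor_set \<alpha> m logarithmic_monoid"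
  shows "multiplicity_of S = m"
  unfolding multiplicity_of_def
proof (rule Least_equality)
  have "alpha_floor \<alpha> (real m * log 2 (real 2)) \<in> int ` S"
    unfolding assms(2) floor_set_def logarithmic_monoid_def by fastforce
  then show "m \<in> S \<and> m \<noteq> 0" using assms(1) alpha_floor_of_int[of \<alpha> "int m"] by auto
next
  fix n assume n: "n \<in> S \<and> n \<noteq> 0"
  then have "int n \<in> floor_set \<alpha> m logarithmic_monoid" using assms(2) by blast
  then obtain i :: nat where i: "i \<ge> 1" "int n = alpha_floor \<alpha> (real m * log 2 (real i))"
    by (auto simp: floor_set_def logarithmic_monoid_def)
  have "i \<noteq> 1" using i(2) n alpha_floor_of_int[of \<alpha> 0] by auto
  then have "1 \<le> log 2 (real i)" using i(1) by (simp add: le_log_iff)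
  then have "of_int (int m) \<le> real m * log 2 (real i)" by (simp add: mult_le_cancel_left1)
  from alpha_floor_ge[OF this, of \<alpha>] show "m \<le> n" using i(2) by simp
qed

theorem theorem7p1:
  fixes m :: nat
  assumes "m \<ge> 1"
  shows "((\<exists>S. numerical_semigroup S \<and> multiplicity_of S = m \<and>
             is_discretization S logarithmic_monoid \<and>
             is_discretization S golden_fractal_monoid)
           \<longleftrightarrow> m \<in> {1, 2, 3, 4, 5, 6, 7, 8, 9, 10, 12, 13, 18})
       \<and> ((\<exists>\<alpha>\<^sub>L\<in>{0..1}. \<exists>\<alpha>\<^sub>F\<in>{0..1}.
             floor_set \<alpha>\<^sub>L m logarithmic_monoid = floor_set \<alpha>\<^sub>F m golden_fractal_monoid \<and>
             (\<exists>S. numerical_semigroup S \<and> int ` S = floor_set \<alpha>\<^sub>L m logarithmic_monoid))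
           \<longleftrightarrow> m \<in> {1, 2, 3, 4, 5, 6, 7, 8, 9, 10, 12, 13, 18})"
    (is "(?semigroup \<longleftrightarrow> ?m) \<and> (?rounding \<longleftrightarrow> ?m)")
proof -
  have semigroup_iff: "?semigroup \<longleftrightarrow> ?rounding"
  proof
    assume ?semigroup
    then show ?rounding unfolding is_discretization_def by metis
  next
    assume ?rounding
    then show ?semigroup
      using multiplicity_of_log_discretization[OF assms] unfolding is_discretization_def by metis
  qed
  have rounding_iff: "?rounding \<longleftrightarrow> ?m"
  proof
    assume ?rounding
    then obtain \<alpha> \<beta> S where *: "\<alpha> \<in> {0..1}" "\<beta> \<in> {0..1}"
      "floor_set \<alpha> m logarithmic_monoid = floor_set \<beta> m golden_fractal_monoid"
      "numerical_semigroup S" "int ` S = floor_set \<alpha> m logarithmic_monoid" by blast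
    then have "m \<le> 30" using discretizations_differ[of m \<alpha> \<beta>] by linarith
    then have "common_truncation m 4" "common_truncation m 5"
      using common_truncation_necessary[OF *] by simp_all
    then have "m \<notin> set [11, 14, 15, 16, 17, 19, 20, 21, 22, 23, 24, 25, 26, 27, 28, 29, 30]"
      using no_common_truncation by blast
    moreover have "\<forall>m\<in>set [1..<31]. m \<in> {1, 2, 3, 4, 5, 6, 7, 8, 9, 10, 12, 13, 18} \<or>
        m \<in> set [11, 14, 15, 16, 17, 19, 20, 21, 22, 23, 24, 25, 26, 27, 28, 29, 30]"
      by code_simp
    moreover have "m \<in> set [1..<31]" using \<open>m \<le> 30\<close> assms by simp
    ultimately show ?m by blast
  next
    assume m: ?m
    then have "\<exists>i a b. common_witness m i (5, a, b)"
      using common_witnesses common_witness_12 common_witness_13 common_witness_18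
      by (elim insertE) auto
    moreover have "m \<le> 18" using m by auto
    ultimately show ?rounding using common_witness_sufficient assms by blast
  qed
  show ?thesis by (rule conjI[OF trans[OF semigroup_iff rounding_iff] rounding_iff])
qed

end
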